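(* Every spin factor satisfies the uniform Kadec-Klee (UKK) property.
   Context: Spin factor: a complex Hilbert space $V$ with inner product $\langle\cdot,\cdot\rangle$, together with a conjugation $\overline{\,\cdot\,}:V\to V$ (a conjugate linear isometry, for the Hilbert norm, of period 2), equipped with the triple product $\{a,b,c\}=\frac12(\langle a,b\rangle c+\langle c,b\rangle a-\langle a,\overline c\rangle\overline b)$ and the norm given by $$\|a\|^2=\langle a,a\rangle+\left(\langle a,a\rangle^2-|\langle a,\overline a\rangle|^2\right)^{1/2},\qquad a\in V.$$ This norm is equivalent to the Hilbert norm $\|\cdot\|_2$: $\|a\|_2\leq\|a\|\leq\sqrt2\,\|a\|_2$. The UKK property refers to the norm $\|\cdot\|$. UKK property: for a sequence $(x_n)$ put $\mathrm{sep}(x_n)=\inf\{\|x_n-x_m\|:n\neq m\}$. A Banach space $X$ satisfies the UKK property if for each $\varepsilon>0$ there exists $\delta>0$ such that every sequence $(x_n)$ in the closed unit ball of $X$ with $\mathrm{sep}(x_n)\geq\varepsilon$ and $x_n\to x$ weakly satisfies $\|x\|<1-\delta$. *)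

theory Defs
  imports "HOL-Analysis.Analysis"
begin

text \<open>Inner products are linear in the first argument, conjugate linear in the second.\<close>

locale complex_inner_product = vector_space scaleC
  for scaleC :: "complex \<Rightarrow> 'v::ab_group_add \<Rightarrow> 'v" +
  fixes ip :: "'v \<Rightarrow> 'v \<Rightarrow> complex"
  assumes ip_add_left: "ip (x + y) z = ip x z + ip y z"
    and ip_scale_left: "ip (scaleC c x) z = c * ip x z"
    and ip_commute: "ip y x = cnj (ip x y)"
    and ip_self_nonneg: "0 \<le> Re (ip x x)"
    and ip_self_eq_0: "ip x x = 0 \<Longrightarrow> x = 0"

text \<open>The value \<open>ip x x\<close> is real by \<open>ip_commute\<close>, so taking its real part is only a coercion.\<close>

definition hilbert_norm :: "('v \<Rightarrow> 'v \<Rightarrow> complex) \<Rightarrow> 'v \<Rightarrow> real" where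
  "hilbert_norm ip x = sqrt (Re (ip x x))"

context complex_inner_product
begin

lemma ip_self_Im: "Im (ip x x) = 0"
  using ip_commute[of x x] by (simp add: complex_eq_iff)

lemma ip_add_right: "ip x (y + z) = ip x y + ip x z"
  by (metis complex_cnj_add ip_add_left ip_commute)

lemma ip_scale_right: "ip x (scaleC c y) = cnj c * ip x y"
  by (metis complex_cnj_mult ip_commute ip_scale_left)

lemma ip_zero_left: "ip 0 x = 0"
  using ip_add_left[of 0 0 x] by simp

lemma Re_ip_commute: "Re (ip x y) = Re (ip y x)"
  using ip_commute[of x y] by simp

lemma Re_ip_self_eq_0: "Re (ip x x) = 0 \<longleftrightarrow> x = 0"
  using ip_self_eq_0[of x] ip_self_Im[of x] ip_zero_left[of 0]
  by (auto simp: complex_eq_iff)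

lemma Re_ip_add_self: "Re (ip (x + y) (x + y)) = Re (ip x x) + 2 * Re (ip x y) + Re (ip y y)"
  using Re_ip_commute[of y x] by (simp add: ip_add_left ip_add_right)

lemma Re_ip_square_le: "(Re (ip x y))\<^sup>2 \<le> Re (ip x x) * Re (ip y y)"
proof (cases "y = 0")
  case True
  then show ?thesis
    using Re_ip_commute[of x 0] by (simp add: ip_zero_left)
next
  case False
  then have C: "Re (ip y y) > 0"
    using ip_self_nonneg[of y] Re_ip_self_eq_0[of y] by linarith
  define t where "t = - Re (ip x y) / Re (ip y y)"
  have "0 \<le> Re (ip x x) + 2 * (t * Re (ip x y)) + t * (t * Re (ip y y))"
    using ip_self_nonneg[of "x + scaleC (of_real t) y"]
    by (simp add: Re_ip_add_self ip_scale_left ip_scale_right)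
  also have "\<dots> = Re (ip x x) - (Re (ip x y))\<^sup>2 / Re (ip y y)"
    using C by (simp add: t_def field_simps power2_eq_square)
  finally show ?thesis
    using C by (simp add: field_simps)
qed

lemma hilbert_norm_triangle: "hilbert_norm ip (x + y) \<le> hilbert_norm ip x + hilbert_norm ip y"
proof -
  have "Re (ip x y) \<le> hilbert_norm ip x * hilbert_norm ip y"
    using Re_ip_square_le[of x y] real_le_rsqrt by (simp add: hilbert_norm_def flip: real_sqrt_mult)
  then have "Re (ip (x + y) (x + y)) \<le> (hilbert_norm ip x + hilbert_norm ip y)\<^sup>2"
    using ip_self_nonneg by (simp add: Re_ip_add_self power2_sum hilbert_norm_def)
  then show ?thesis
    using ip_self_nonneg by (simp add: hilbert_norm_def real_le_lsqrt)
qed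

lemma hilbert_norm_minus: "hilbert_norm ip (- x) = hilbert_norm ip x"
  using ip_scale_left[of "-1" x] ip_scale_right[of _ "-1" x] by (simp add: hilbert_norm_def)

lemma Metric_space_hilbert: "Metric_space UNIV (\<lambda>x y. hilbert_norm ip (x - y))"
proof
  show "0 \<le> hilbert_norm ip (x - y)" for x y
    using ip_self_nonneg by (simp add: hilbert_norm_def)
  show "hilbert_norm ip (x - y) = hilbert_norm ip (y - x)" for x y
    using hilbert_norm_minus[of "x - y"] by simp
  show "hilbert_norm ip (x - y) = 0 \<longleftrightarrow> x = y" for x y
    using Re_ip_self_eq_0[of "x - y"] by (simp add: hilbert_norm_def)
  show "hilbert_norm ip (x - z) \<le> hilbert_norm ip (x - y) + hilbert_norm ip (y - z)" for x y z
    using hilbert_norm_triangle[of "x - y" "y - z"] by simp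
qed

end

locale complex_hilbert_space = complex_inner_product +
  assumes complete: "Metric_space.mcomplete UNIV (\<lambda>x y. hilbert_norm ip (x - y))"

locale spin_factor = complex_hilbert_space scaleC ip
  for scaleC :: "complex \<Rightarrow> 'v::ab_group_add \<Rightarrow> 'v" and ip :: "'v \<Rightarrow> 'v \<Rightarrow> complex" +
  fixes cjg :: "'v \<Rightarrow> 'v"
  assumes conj_add: "cjg (x + y) = cjg x + cjg y"
    and conj_scale: "cjg (scaleC c x) = scaleC (cnj c) (cjg x)"
    and conj_isometry: "hilbert_norm ip (cjg x) = hilbert_norm ip x"
    and conj_conj: "cjg (cjg x) = x"

definition spin_triple ::
  "(complex \<Rightarrow> 'v::ab_group_add \<Rightarrow> 'v) \<Rightarrow> ('v \<Rightarrow> 'v \<Rightarrow> complex) \<Rightarrow> ('v \<Rightarrow> 'v) \<Rightarrow> 'v \<Rightarrow> 'v \<Rightarrow> 'v \<Rightarrow> 'v"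
  where
  "spin_triple scaleC ip cjg a b c =
     scaleC (1/2) (scaleC (ip a b) c + scaleC (ip c b) a - scaleC (ip a (cjg c)) (cjg b))"

definition spin_norm :: "('v \<Rightarrow> 'v \<Rightarrow> complex) \<Rightarrow> ('v \<Rightarrow> 'v) \<Rightarrow> 'v \<Rightarrow> real" where
  "spin_norm ip cjg a =
     sqrt (Re (ip a a) + sqrt ((Re (ip a a))\<^sup>2 - (cmod (ip a (cjg a)))\<^sup>2))"

text \<open>
  In what follows a complex normed space is given by its scalar multiplication and a norm \<open>N\<close>
  on a type, since the spin norm is not the norm of a type class.
\<close>

definition bounded_functional ::
  "(complex \<Rightarrow> 'v::ab_group_add \<Rightarrow> 'v) \<Rightarrow> ('v \<Rightarrow> real) \<Rightarrow> ('v \<Rightarrow> complex) \<Rightarrow> bool" where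
  "bounded_functional scaleC N f \<longleftrightarrow>
     Vector_Spaces.linear scaleC (*) f \<and> (\<exists>K. \<forall>x. cmod (f x) \<le> K * N x)"

definition weakly_converges ::
  "(complex \<Rightarrow> 'v::ab_group_add \<Rightarrow> 'v) \<Rightarrow> ('v \<Rightarrow> real) \<Rightarrow> (nat \<Rightarrow> 'v) \<Rightarrow> 'v \<Rightarrow> bool" where
  "weakly_converges scaleC N x l \<longleftrightarrow>
     (\<forall>f. bounded_functional scaleC N f \<longrightarrow> (\<lambda>n. f (x n)) \<longlonglongrightarrow> f l)"

definition sep :: "('v::ab_group_add \<Rightarrow> real) \<Rightarrow> (nat \<Rightarrow> 'v) \<Rightarrow> real" where
  "sep N x = Inf {N (x n - x m) | n m. n \<noteq> m}"

definition UKK :: "(complex \<Rightarrow> 'v::ab_group_add \<Rightarrow> 'v) \<Rightarrow> ('v \<Rightarrow> real) \<Rightarrow> bool" where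
  "UKK scaleC N \<longleftrightarrow>
     (\<forall>\<epsilon>>0. \<exists>\<delta>>0. \<forall>x l.
        (\<forall>n. N (x n) \<le> 1) \<and> sep N x \<ge> \<epsilon> \<and> weakly_converges scaleC N x l \<longrightarrow> N l < 1 - \<delta>)"

end

theory Submission
  imports Defs
begin

text \<open>
  Write \<open>S a = \<langle>a, a\<rangle>\<close> and \<open>D a = \<langle>a, cjg a\<rangle>\<close>, so that the square of the spin norm is
  \<open>S a + sqrt ((S a)\<^sup>2 - \<bar>D a\<bar>\<^sup>2)\<close> with \<open>\<bar>D a\<bar> \<le> S a\<close>.  Let \<open>x\<^sub>n = l + y\<^sub>n\<close> be a sequence
  in the unit ball with weak limit \<open>l\<close>.  Since \<open>y\<^sub>n\<close> is weakly null, the mixed terms in the expansions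
  of \<open>S (l + y\<^sub>n)\<close> and \<open>D (l + y\<^sub>n)\<close> vanish in the limit, and \<open>\<bar>D y\<^sub>n\<bar> \<le> S y\<^sub>n\<close>.  So along a
  subsequence on which \<open>S y\<^sub>n\<close> converges, say to \<open>q\<close>, the quantity \<open>S x\<^sub>n\<close> tends to \<open>S l + q\<close>,
  whereas \<open>\<bar>D x\<^sub>n\<bar>\<close> is at most \<open>\<bar>D l\<bar> + q\<close> up to an error tending to zero.  Adding \<open>q\<close> to both
  \<open>S l\<close> and \<open>\<bar>D l\<bar>\<close> does not decrease the expression under the root
  (\<open>spin_expression_add_le\<close>), hence \<open>\<parallel>l\<parallel>\<^sup>2 + q \<le> 1\<close>.

  Separation bounds \<open>q\<close> from below: for fixed \<open>k\<close> and \<open>n \<longlonglongrightarrow> \<infinity>\<close>, weak nullity makes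
  \<open>S (y\<^sub>n - y\<^sub>k)\<close> tend to \<open>q + S y\<^sub>k\<close>, and \<open>S\<close> is at least half the squared spin norm, so
  \<open>\<epsilon>\<^sup>2/2 \<le> 2 q\<close>.  Thus \<open>\<parallel>l\<parallel>\<^sup>2 \<le> 1 - \<epsilon>\<^sup>2/4\<close>, a bound depending on \<open>\<epsilon>\<close> only
  (\<open>spin_norm_weak_limit_le\<close>).
\<close>

section \<open>A real inequality and separated sequences\<close>

text \<open>
  The difference of squares \<open>s\<^sup>2 - d\<^sup>2\<close> grows by \<open>2 q (s - d)\<close> when both terms are raised by \<open>q\<close>.
\<close>

lemma spin_expression_add_le:
  fixes s d q :: real
  assumes "d \<le> s" "0 \<le> q"
  shows "s + sqrt (s\<^sup>2 - d\<^sup>2) + q \<le> (s + q) + sqrt ((s + q)\<^sup>2 - (d + q)\<^sup>2)"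
proof -
  have "(s + q)\<^sup>2 - (d + q)\<^sup>2 = s\<^sup>2 - d\<^sup>2 + 2 * (q * (s - d))"
    by (simp add: power2_eq_square algebra_simps)
  moreover have "0 \<le> q * (s - d)"
    using assms by simp
  ultimately show ?thesis
    by simp
qed

lemma sep_le:
  assumes "\<And>a. 0 \<le> N a" "n \<noteq> m"
  shows "sep N x \<le> N (x n - x m)"
  unfolding sep_def by (rule cInf_lower) (use assms in \<open>auto intro: bdd_belowI[of _ 0]\<close>)

section \<open>Complex inner products\<close>

context complex_inner_product
begin

lemma hilbert_norm_nonneg: "0 \<le> hilbert_norm ip x"
  using ip_self_nonneg by (simp add: hilbert_norm_def)

lemma hilbert_norm_power2: "(hilbert_norm ip x)\<^sup>2 = Re (ip x x)"
  using ip_self_nonneg by (simp add: hilbert_norm_def)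

text \<open>
  Multiplying \<open>x\<close> by the conjugate of \<open>ip x y\<close> makes the inner product with \<open>y\<close> real, which reduces
  the complex inequality to the one for real parts.
\<close>

lemma cmod_ip_le: "cmod (ip x y) \<le> hilbert_norm ip x * hilbert_norm ip y"
proof (cases "ip x y = 0")
  case True
  then show ?thesis
    by (simp add: hilbert_norm_nonneg)
next
  case False
  define c where "c = cnj (ip x y)"
  have sq: "cnj z * z = of_real ((cmod z)\<^sup>2)" "z * cnj z = of_real ((cmod z)\<^sup>2)" for z
    by (simp_all only: complex_norm_square mult.commute[of "cnj z"])
  have "ip (scaleC c x) y = of_real ((cmod (ip x y))\<^sup>2)"
    by (simp add: ip_scale_left c_def sq)
  moreover have "ip (scaleC c x) (scaleC c x) = of_real ((cmod (ip x y))\<^sup>2) * ip x x"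
    by (simp only: ip_scale_left ip_scale_right mult.assoc[symmetric] sq) (simp add: c_def)
  ultimately have "((cmod (ip x y))\<^sup>2)\<^sup>2 \<le> (cmod (ip x y))\<^sup>2 * Re (ip x x) * Re (ip y y)"
    using Re_ip_square_le[of "scaleC c x" y] by (simp del: of_real_power)
  then have "(cmod (ip x y))\<^sup>2 * (cmod (ip x y))\<^sup>2
      \<le> (cmod (ip x y))\<^sup>2 * (Re (ip x x) * Re (ip y y))"
    by (simp add: power2_eq_square mult.assoc)
  moreover have "0 < (cmod (ip x y))\<^sup>2"
    using False by simp
  ultimately have "(cmod (ip x y))\<^sup>2 \<le> Re (ip x x) * Re (ip y y)"
    by (rule mult_left_le_imp_le)
  then have "(cmod (ip x y))\<^sup>2 \<le> (hilbert_norm ip x * hilbert_norm ip y)\<^sup>2"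
    by (simp add: power_mult_distrib hilbert_norm_power2)
  then show ?thesis
    by (rule power2_le_imp_le) (simp add: hilbert_norm_nonneg)
qed

lemma ip_minus_right: "ip x (- y) = - ip x y"
  using ip_scale_right[of x "-1" y] by simp

lemma Re_ip_diff_self: "Re (ip (x - y) (x - y)) = Re (ip x x) - 2 * Re (ip x y) + Re (ip y y)"
  using Re_ip_add_self[of x "- y"] hilbert_norm_power2[of y] hilbert_norm_power2[of "- y"]
  by (simp add: ip_minus_right hilbert_norm_minus)

end

section \<open>The spin norm and its bounded functionals\<close>

context spin_factor
begin

lemma cmod_ip_cjg_le: "cmod (ip a (cjg a)) \<le> Re (ip a a)"
  using cmod_ip_le[of a "cjg a"] hilbert_norm_power2[of a]
  by (simp add: conj_isometry power2_eq_square)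

lemma spin_root_nonneg: "0 \<le> sqrt ((Re (ip a a))\<^sup>2 - (cmod (ip a (cjg a)))\<^sup>2)"
  using power_mono[OF cmod_ip_cjg_le[of a], of 2] by simp

lemma spin_norm_nonneg: "0 \<le> spin_norm ip cjg a"
  using spin_root_nonneg[of a] ip_self_nonneg[of a] by (simp add: spin_norm_def)

lemma spin_norm_power2:
  "(spin_norm ip cjg a)\<^sup>2 = Re (ip a a) + sqrt ((Re (ip a a))\<^sup>2 - (cmod (ip a (cjg a)))\<^sup>2)"
  using spin_root_nonneg[of a] ip_self_nonneg[of a] by (simp add: spin_norm_def)

lemma hilbert_norm_le_spin_norm: "hilbert_norm ip a \<le> spin_norm ip cjg a"
  using spin_root_nonneg[of a] by (simp add: spin_norm_def hilbert_norm_def)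

lemma spin_norm_power2_le: "(spin_norm ip cjg a)\<^sup>2 \<le> 2 * Re (ip a a)"
proof -
  have "sqrt ((Re (ip a a))\<^sup>2 - (cmod (ip a (cjg a)))\<^sup>2) \<le> sqrt ((Re (ip a a))\<^sup>2)"
    by (rule real_sqrt_le_mono) simp
  then show ?thesis
    using ip_self_nonneg[of a] by (simp add: spin_norm_power2)
qed

lemma bounded_functional_spinI:
  assumes "\<And>x y. f (x + y) = f x + f y" "\<And>c x. f (scaleC c x) = c * f x"
    and bound: "\<And>x. cmod (f x) \<le> hilbert_norm ip x * K" "0 \<le> K"
  shows "bounded_functional scaleC (spin_norm ip cjg) f"
proof -
  have "vector_space ((*) :: complex \<Rightarrow> complex \<Rightarrow> complex)"
    by unfold_locales (simp_all add: algebra_simps)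
  then have "Vector_Spaces.linear scaleC (*) f"
    using assms vector_space_axioms
    by (simp add: Vector_Spaces.linear_def module_hom_def module_hom_axioms_def
        module_iff_vector_space)
  moreover have "cmod (f x) \<le> K * spin_norm ip cjg x" for x
    using bound(1)[of x] mult_right_mono[OF hilbert_norm_le_spin_norm[of x] bound(2)]
    by (simp add: mult.commute)
  ultimately show ?thesis
    unfolding bounded_functional_def by blast
qed

lemma bounded_functional_ip: "bounded_functional scaleC (spin_norm ip cjg) (\<lambda>x. ip x z)"
  by (rule bounded_functional_spinI[where K = "hilbert_norm ip z"])
    (simp_all add: ip_add_left ip_scale_left cmod_ip_le hilbert_norm_nonneg)

text \<open>
  Two conjugate linearities cancel here: that of \<open>cjg\<close> and that of the second argument of \<open>ip\<close>.
\<close>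

lemma bounded_functional_ip_cjg:
  "bounded_functional scaleC (spin_norm ip cjg) (\<lambda>x. ip z (cjg x))"
proof (rule bounded_functional_spinI[where K = "hilbert_norm ip z"])
  show "cmod (ip z (cjg x)) \<le> hilbert_norm ip x * hilbert_norm ip z" for x
    using cmod_ip_le[of z "cjg x"] by (simp add: conj_isometry mult.commute)
qed (simp_all add: conj_add conj_scale ip_add_right ip_scale_right hilbert_norm_nonneg)

lemma weakly_null_diff:
  assumes "weakly_converges scaleC (spin_norm ip cjg) x l"
    and "bounded_functional scaleC (spin_norm ip cjg) f"
  shows "(\<lambda>n. f (x n - l)) \<longlonglongrightarrow> 0"
proof -
  have "module_hom scaleC (*) f"
    using assms(2) by (simp add: bounded_functional_def Vector_Spaces.linear_def module_hom_def
        module_iff_vector_space)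
  then have "f (a - b) = f a - f b" for a b
    by (rule module_hom.diff)
  then show ?thesis
    using assms by (simp add: weakly_converges_def LIM_zero)
qed

section \<open>Weak limits of separated sequences\<close>

text \<open>
  In a Hilbert space the bound would be \<open>1 - \<epsilon>\<^sup>2/2\<close>; a sequence that is \<open>\<epsilon>\<close>-separated for the spin norm
  is \<open>\<epsilon>/sqrt 2\<close>-separated for the Hilbert norm, whence the 4.
\<close>

lemma spin_norm_weak_limit_le:
  assumes ball: "\<And>n. spin_norm ip cjg (x n) \<le> 1"
    and separated: "\<And>n m. n \<noteq> m \<Longrightarrow> \<epsilon> \<le> spin_norm ip cjg (x n - x m)"
    and weak: "weakly_converges scaleC (spin_norm ip cjg) x l"
    and "0 < \<epsilon>"
  shows "(spin_norm ip cjg l)\<^sup>2 \<le> 1 - \<epsilon>\<^sup>2 / 4"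
proof -
  define y where "y n = x n - l" for n
  define S where "S a = Re (ip a a)" for a
  define D where "D a = cmod (ip a (cjg a))" for a
  have x_eq: "x n = l + y n" for n
    by (simp add: y_def)
  have null: "(\<lambda>n. ip (y n) z) \<longlonglongrightarrow> 0" "(\<lambda>n. ip z (cjg (y n))) \<longlonglongrightarrow> 0" for z
    using weakly_null_diff[OF weak bounded_functional_ip]
      weakly_null_diff[OF weak bounded_functional_ip_cjg]
    by (simp_all add: y_def)

  have "bounded (range (\<lambda>n. S (y n)))"
  proof (rule boundedI)
    fix r assume "r \<in> range (\<lambda>n. S (y n))"
    then obtain n where r: "r = S (y n)" by blast
    have "hilbert_norm ip (y n) \<le> hilbert_norm ip (x n) + hilbert_norm ip l"
      using hilbert_norm_triangle[of "x n" "- l"] by (simp add: y_def hilbert_norm_minus)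
    also have "\<dots> \<le> 1 + hilbert_norm ip l"
      using hilbert_norm_le_spin_norm[of "x n"] ball[of n] by simp
    finally have "(hilbert_norm ip (y n))\<^sup>2 \<le> (1 + hilbert_norm ip l)\<^sup>2"
      by (rule power_mono) (rule hilbert_norm_nonneg)
    then show "norm r \<le> (1 + hilbert_norm ip l)\<^sup>2"
      using ip_self_nonneg[of "y n"] by (simp add: r S_def hilbert_norm_power2)
  qed
  then obtain q r where r: "strict_mono r" and q: "(\<lambda>n. S (y (r n))) \<longlonglongrightarrow> q"
    using bounded_imp_convergent_subsequence[of "\<lambda>n. S (y n)"] by (auto simp: o_def)
  have null': "(\<lambda>n. ip (y (r n)) z) \<longlonglongrightarrow> 0" "(\<lambda>n. ip z (cjg (y (r n)))) \<longlonglongrightarrow> 0" for z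
    using null[of z] LIMSEQ_subseq_LIMSEQ[OF _ r] by (auto simp: o_def)
  have Re_null: "(\<lambda>n. Re (ip (y (r n)) z)) \<longlonglongrightarrow> 0" for z
    using tendsto_Re[OF null'(1)] by simp

  have "\<epsilon>\<^sup>2 / 2 \<le> q - 2 * 0 + S (y (r k))" for k
  proof (rule LIMSEQ_le_const)
    show "(\<lambda>n. S (y (r n)) - 2 * Re (ip (y (r n)) (y (r k))) + S (y (r k)))
        \<longlonglongrightarrow> q - 2 * 0 + S (y (r k))"
      by (intro tendsto_intros q Re_null)
    show "\<exists>N. \<forall>n\<ge>N. \<epsilon>\<^sup>2 / 2 \<le> S (y (r n)) - 2 * Re (ip (y (r n)) (y (r k))) + S (y (r k))"
    proof (intro exI allI impI)
      fix n assume "Suc k \<le> n"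
      then have "r n \<noteq> r k"
        using strict_mono_eq[OF r] by simp
      then have "\<epsilon>\<^sup>2 \<le> (spin_norm ip cjg (x (r n) - x (r k)))\<^sup>2"
        using separated \<open>0 < \<epsilon>\<close> by (intro power_mono) auto
      also have "\<dots> \<le> 2 * Re (ip (y (r n) - y (r k)) (y (r n) - y (r k)))"
        using spin_norm_power2_le[of "x (r n) - x (r k)"] by (simp add: y_def)
      finally show "\<epsilon>\<^sup>2 / 2 \<le> S (y (r n)) - 2 * Re (ip (y (r n)) (y (r k))) + S (y (r k))"
        by (simp add: Re_ip_diff_self S_def)
    qed
  qed
  then have "\<epsilon>\<^sup>2 / 2 \<le> q + q"
    by (intro LIMSEQ_le_const[OF tendsto_add[OF tendsto_const q]]) auto
  then have q_ge: "\<epsilon>\<^sup>2 / 4 \<le> q"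
    by simp

  define s where "s n = S (x (r n))" for n
  define d where
    "d n = D l + cmod (ip l (cjg (y (r n)))) + cmod (ip (y (r n)) (cjg l)) + S (y (r n))" for n
  have s_eq: "s n = S l + 2 * Re (ip (y (r n)) l) + S (y (r n))" for n
    using Re_ip_add_self[of l "y (r n)"] Re_ip_commute[of l "y (r n)"]
    by (simp add: s_def S_def x_eq)
  have s_lim: "s \<longlonglongrightarrow> S l + 2 * 0 + q"
    unfolding s_eq by (intro tendsto_intros q Re_null)
  have d_lim: "d \<longlonglongrightarrow> D l + 0 + 0 + q"
    unfolding d_def by (intro tendsto_intros q tendsto_norm_zero null')
  have D_le: "D (x (r n)) \<le> d n" for n
  proof -
    let ?y = "y (r n)"
    have "D (x (r n)) = cmod (ip l (cjg l) + ip l (cjg ?y) + ip ?y (cjg l) + ip ?y (cjg ?y))"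
      by (simp add: D_def x_eq conj_add ip_add_left ip_add_right algebra_simps)
    also have "\<dots> \<le> D l + cmod (ip l (cjg ?y)) + cmod (ip ?y (cjg l)) + D ?y"
      unfolding D_def by (intro norm_triangle_mono order_refl)
    also have "\<dots> \<le> d n"
      using cmod_ip_cjg_le[of ?y] by (simp add: d_def D_def S_def)
    finally show ?thesis .
  qed
  have le_1: "s n + sqrt ((s n)\<^sup>2 - (d n)\<^sup>2) \<le> 1" for n
  proof -
    \<comment> \<open>The radicand on the left may be negative; \<open>sqrt\<close> is monotone on all of the real line.\<close>
    have "sqrt ((s n)\<^sup>2 - (d n)\<^sup>2) \<le> sqrt ((s n)\<^sup>2 - (D (x (r n)))\<^sup>2)"
      using D_le[of n] by (intro real_sqrt_le_mono diff_left_mono power_mono) (simp_all add: D_def)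
    moreover have "(spin_norm ip cjg (x (r n)))\<^sup>2 \<le> 1"
      using ball spin_norm_nonneg by (simp add: power_le_one)
    ultimately show ?thesis
      unfolding spin_norm_power2 s_def S_def D_def by linarith
  qed
  have "(\<lambda>n. s n + sqrt ((s n)\<^sup>2 - (d n)\<^sup>2))
      \<longlonglongrightarrow> (S l + 2 * 0 + q) + sqrt ((S l + 2 * 0 + q)\<^sup>2 - (D l + 0 + 0 + q)\<^sup>2)"
    by (intro tendsto_intros s_lim d_lim)
  then have "(S l + 2 * 0 + q) + sqrt ((S l + 2 * 0 + q)\<^sup>2 - (D l + 0 + 0 + q)\<^sup>2) \<le> 1"
    by (rule LIMSEQ_le_const2) (use le_1 in blast)
  moreover have "0 \<le> q"
    using q_ge zero_le_power2[of \<epsilon>] by linarith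
  ultimately have "S l + sqrt ((S l)\<^sup>2 - (D l)\<^sup>2) + q \<le> 1"
    using spin_expression_add_le[OF cmod_ip_cjg_le[of l], of q]
    unfolding S_def D_def mult_zero_right add_0_right by linarith
  then show ?thesis
    using q_ge by (simp add: spin_norm_power2 S_def D_def)
qed

end

theorem theorem4p1:
  fixes scaleC :: "complex \<Rightarrow> 'v::ab_group_add \<Rightarrow> 'v"
    and ip :: "'v \<Rightarrow> 'v \<Rightarrow> complex"
    and cjg :: "'v \<Rightarrow> 'v"
  assumes "spin_factor scaleC ip cjg"
  shows "UKK scaleC (spin_norm ip cjg)"
proof -
  interpret spin_factor scaleC ip cjg
    by (rule assms)
  have *: "spin_norm ip cjg l < 1 - \<epsilon>\<^sup>2 / 16"
    if "0 < \<epsilon>" and ball: "\<And>n. spin_norm ip cjg (x n) \<le> 1"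
      and sep: "\<epsilon> \<le> sep (spin_norm ip cjg) x"
      and weak: "weakly_converges scaleC (spin_norm ip cjg) x l" for \<epsilon> x l
  proof -
    have "\<epsilon> \<le> spin_norm ip cjg (x n - x m)" if "n \<noteq> m" for n m
      using sep sep_le[OF spin_norm_nonneg that] by (rule order_trans)
    then have sq_le: "(spin_norm ip cjg l)\<^sup>2 \<le> 1 - \<epsilon>\<^sup>2 / 4"
      using spin_norm_weak_limit_le ball weak \<open>0 < \<epsilon>\<close> by blast
    \<comment> \<open>The tangent line of the square root at 1: \<open>sqrt (1 - t) \<le> 1 - t/2\<close>, with \<open>t = \<epsilon>\<^sup>2/4\<close>.
      Halving the gap once more makes the inequality strict.\<close>
    also have "\<dots> \<le> (1 - \<epsilon>\<^sup>2 / 8)\<^sup>2"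
      by (simp add: power2_diff)
    finally have "spin_norm ip cjg l \<le> 1 - \<epsilon>\<^sup>2 / 8"
    proof (rule power2_le_imp_le)
      show "0 \<le> 1 - \<epsilon>\<^sup>2 / 8"
        using sq_le zero_le_power2[of "spin_norm ip cjg l"] by linarith
    qed
    moreover have "0 < \<epsilon>\<^sup>2"
      using \<open>0 < \<epsilon>\<close> by simp
    ultimately show ?thesis
      by linarith
  qed
  show ?thesis
    unfolding UKK_def
  proof (intro allI impI)
    fix \<epsilon> :: real assume "0 < \<epsilon>"
    then show "\<exists>\<delta>>0. \<forall>x l. (\<forall>n. spin_norm ip cjg (x n) \<le> 1) \<and> \<epsilon> \<le> sep (spin_norm ip cjg) x \<and>
        weakly_converges scaleC (spin_norm ip cjg) x l \<longrightarrow> spin_norm ip cjg l < 1 - \<delta>"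
      using *[of \<epsilon>] by (intro exI[of _ "\<epsilon>\<^sup>2 / 16"] conjI allI impI) (simp, blast)
  qed
qed

end
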